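(* Let $X$ be a Banach space, let $T\in L(X)$, and let $\mathfrak A\subseteq L(X)$ be the norm closed algebra generated by $T$. If there exists a half-space of $X$ that is almost invariant under every operator in $\mathfrak A$, then there exists a half-space of $X$ that is invariant under every operator in $\mathfrak A$.
   Context: $L(X)$ denotes the algebra of bounded linear operators on $X$. A half-space of $X$ is a norm closed linear subspace $Y\subseteq X$ of infinite dimension and infinite codimension. A closed subspace $Y$ is almost invariant under $S\in L(X)$ if there is a finite-dimensional subspace $F\subseteq X$ (depending on $S$) with $SY\subseteq Y+F$; it is invariant under $S$ if $SY\subseteq Y$. The norm closed algebra generated by $T$ is the smallest norm closed subalgebra of $L(X)$ containing $T$. *)

theory Defs
  imports "HOL-Analysis.Analysis"
begin

(* Banach spaces over a complete normed field 'k containing the reals. The instances are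
   'k = real and 'k = complex (by Gelfand-Mazur there are no others up to isomorphism), so both
   scalar fields are covered. The library class banach supplies the underlying real Banach space;
   "scale" is the scalar multiplication that counts for linearity, subspaces and dimension. *)
locale banach_space_over = vector_space scale
  for scale :: "'k::{real_normed_field,banach} \<Rightarrow> 'a::banach \<Rightarrow> 'a" +
  assumes norm_scale: "norm (scale c x) = norm c * norm x"
    and scale_of_real: "scale (of_real r) x = r *\<^sub>R x"
begin

(* L(X): the library type of bounded real-linear maps, cut down to the 'k-linear ones.
   Its norm is the operator norm. *)
definition operators :: "('a \<Rightarrow>\<^sub>L 'a) set" where
  "operators = {S. \<forall>c x. blinfun_apply S (scale c x) = scale c (blinfun_apply S x)}"

definition scale_op :: "'k \<Rightarrow> ('a \<Rightarrow>\<^sub>L 'a) \<Rightarrow> ('a \<Rightarrow>\<^sub>L 'a)" where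
  "scale_op c S = Blinfun (\<lambda>x. scale c (blinfun_apply S x))"

lemma scale_op_apply: "blinfun_apply (scale_op c S) x = scale c (blinfun_apply S x)"
proof -
  have "bounded_linear (scale c)"
  proof (rule bounded_linear_intro[where K = "norm c"])
    fix r y
    have "scale c (r *\<^sub>R y) = scale (c * of_real r) y"
      by (simp add: scale_of_real[symmetric])
    also have "\<dots> = r *\<^sub>R scale c y"
      by (simp add: scale_of_real[symmetric] mult.commute)
    finally show "scale c (r *\<^sub>R y) = r *\<^sub>R scale c y" .
  qed (auto simp: scale_right_distrib norm_scale mult.commute)
  then have "bounded_linear (\<lambda>x. scale c (blinfun_apply S x))"
    using bounded_linear_compose blinfun.bounded_linear_right by blast
  then show ?thesis
    by (simp add: scale_op_def bounded_linear_Blinfun_apply)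
qed

(* Subalgebras are not required to contain the identity operator. *)
definition closed_subalgebra :: "('a \<Rightarrow>\<^sub>L 'a) set \<Rightarrow> bool" where
  "closed_subalgebra A \<longleftrightarrow>
     A \<subseteq> operators \<and> closed A \<and> 0 \<in> A \<and>
     (\<forall>S\<in>A. \<forall>R\<in>A. S + R \<in> A) \<and>
     (\<forall>c. \<forall>S\<in>A. scale_op c S \<in> A) \<and>
     (\<forall>S\<in>A. \<forall>R\<in>A. S o\<^sub>L R \<in> A)"

definition generated_closed_algebra :: "('a \<Rightarrow>\<^sub>L 'a) \<Rightarrow> ('a \<Rightarrow>\<^sub>L 'a) set" where
  "generated_closed_algebra T = closed_subalgebra hull {T}"

definition finite_dim_subspace :: "'a set \<Rightarrow> bool" where
  "finite_dim_subspace F \<longleftrightarrow> (\<exists>B. finite B \<and> F = span B)"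

(* Infinite codimension: X/Y is not spanned by finitely many classes, i.e. X is not Y + F for
   any finite-dimensional F. *)
definition half_space :: "'a set \<Rightarrow> bool" where
  "half_space Y \<longleftrightarrow>
     closed Y \<and> subspace Y \<and> \<not> finite_dim_subspace Y \<and>
     \<not> (\<exists>F. finite_dim_subspace F \<and> {y + f |y f. y \<in> Y \<and> f \<in> F} = UNIV)"

definition almost_invariant :: "'a set \<Rightarrow> ('a \<Rightarrow>\<^sub>L 'a) \<Rightarrow> bool" where
  "almost_invariant Y S \<longleftrightarrow>
     (\<exists>F. finite_dim_subspace F \<and> blinfun_apply S ` Y \<subseteq> {y + f |y f. y \<in> Y \<and> f \<in> F})"

lemma closed_operators: "closed operators"
proof -
  have "operators =
      (\<Inter>c. \<Inter>x. {S. blinfun_apply S (scale c x) = blinfun_apply (scale_op c id_blinfun) (blinfun_apply S x)})"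
    by (auto simp: operators_def scale_op_apply)
  also have "closed \<dots>"
    by (intro closed_INT ballI closed_Collect_eq continuous_intros)
  finally show ?thesis .
qed

lemma closed_subalgebra_operators: "closed_subalgebra operators"
  unfolding closed_subalgebra_def
  using closed_operators
  by (auto simp: operators_def scale_op_apply blinfun.add_left scale_right_distrib mult.commute)

lemma closed_subalgebra_generated:
  assumes "T \<in> operators"
  shows "closed_subalgebra (generated_closed_algebra T)"
proof -
  have "generated_closed_algebra T = \<Inter>{A. closed_subalgebra A \<and> T \<in> A}"
    by (simp add: generated_closed_algebra_def hull_def)
  moreover have "closed_subalgebra (\<Inter>{A. closed_subalgebra A \<and> T \<in> A})"
    using closed_subalgebra_operators assms
    unfolding closed_subalgebra_def by (auto intro!: closed_Inter)
  ultimately show ?thesis by simp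
qed

end

definition invariant_under :: "'a::real_normed_vector set \<Rightarrow> ('a \<Rightarrow>\<^sub>L 'a) \<Rightarrow> bool" where
  "invariant_under Y S \<longleftrightarrow> blinfun_apply S ` Y \<subseteq> Y"

lemma banach_space_over_real: "banach_space_over (scaleR :: real \<Rightarrow> 'a::banach \<Rightarrow> 'a)"
  by unfold_locales (auto simp: algebra_simps)

lemma banach_space_over_complex: "banach_space_over ((*) :: complex \<Rightarrow> complex \<Rightarrow> complex)"
  by unfold_locales (auto simp: algebra_simps norm_mult scaleR_conv_of_real)

end

theory Submission
  imports Defs
begin

text \<open>
  Call the rank of an operator S the dimension of (SY + Y)/Y. Having rank at least n is an
  open condition on S, so Baire's theorem yields a ball of the algebra on which the rank is
  bounded. Let S have maximal rank m in that ball, and let S y_1, ..., S y_m be independent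
  modulo Y, with span F. If y \<in> Y and S y \<in> Y, then R y \<in> Y + F for every R in the algebra:
  otherwise S + tR would have rank greater than m for small t, as witnessed by
  y_1, ..., y_m, y. Hence the elements z of Y + F such that R z \<in> Y + F for all R form an
  invariant closed subspace containing the subspace of all such y, which has finite codimension
  in Y.
\<close>

context banach_space_over
begin

section \<open>Closed subspaces enlarged by finitely many vectors\<close>

lemmas span_subspace_id = span_eq_iff[THEN iffD2]

lemma bounded_linear_scale_left: "bounded_linear (\<lambda>c. scale c x)"
proof (rule bounded_linear_intro[where K = "norm x"])
  fix r :: real and c
  have "scale (r *\<^sub>R c) x = scale (of_real r * c) x"
    by (simp add: scaleR_conv_of_real)
  then show "scale (r *\<^sub>R c) x = r *\<^sub>R scale c x"
    by (simp flip: scale_of_real)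
qed (auto simp: scale_left_distrib norm_scale)

text \<open>Some ball of radius \<open>d\<close> about \<open>a\<close> misses \<open>W\<close>;
  multiplying by \<open>c\<close> turns this into an estimate uniform in \<open>w\<close>. It says
  that the coefficient of \<open>a\<close> depends boundedly on the vector.\<close>

lemma dist_closed_subspace:
  assumes "closed W" "subspace W" "a \<notin> W"
  obtains d where "d > 0" "\<And>w c. w \<in> W \<Longrightarrow> d * norm c \<le> norm (w + scale c a)"
proof -
  obtain d where d: "d > 0" "ball a d \<inter> W = {}"
    using assms(1,3) open_contains_ball[of "- W"] unfolding closed_def by blast
  have "d * norm c \<le> norm (w + scale c a)" if "w \<in> W" for w c
  proof (cases "c = 0")
    case False
    have "scale (- inverse c) w \<in> W"
      using that assms(2) by (rule subspace_scale[rotated])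
    then have "d \<le> norm (a - scale (- inverse c) w)"
      using d(2) by (force simp: dist_norm)
    then have "norm c * d \<le> norm c * norm (a - scale (- inverse c) w)"
      by (rule mult_left_mono) simp
    moreover have "w + scale c a = scale c (a - scale (- inverse c) w)"
      using False by (simp add: scale_right_distrib)
    ultimately show ?thesis
      by (simp add: norm_scale mult.commute)
  qed simp
  with d(1) that show thesis by blast
qed

text \<open>Along a convergent sequence the coefficients of \<open>a\<close> are Cauchy by the
  distance estimate, so they converge in the complete scalar field. The components in
  \<open>W\<close> then converge as well, and \<open>W\<close> is closed.\<close>

lemma closed_span_insert:
  assumes "closed W" "subspace W"
  shows "closed (span (insert a W))"
proof (cases "a \<in> W")
  case True
  then show ?thesis using assms by (simp add: insert_absorb span_subspace_id)
next
  case False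
  obtain d where d: "d > 0" "\<And>w c. w \<in> W \<Longrightarrow> d * norm c \<le> norm (w + scale c a)"
    using dist_closed_subspace[OF assms False] by blast
  show ?thesis
    unfolding closed_sequential_limits
  proof (intro allI impI, elim conjE)
    fix v l assume v: "\<forall>n. v n \<in> span (insert a W)" and lim: "v \<longlonglongrightarrow> l"
    have "\<forall>n. \<exists>c. v n - scale c a \<in> W"
      using v assms(2) by (auto simp: span_breakdown_eq span_subspace_id)
    then obtain c where c: "\<And>n. v n - scale (c n) a \<in> W"
      by metis
    have bound: "d * norm (c m - c n) \<le> norm (v m - v n)" for m n
    proof -
      have "(v m - scale (c m) a) - (v n - scale (c n) a) \<in> W"
        using assms(2) c c by (rule subspace_diff)
      from d(2)[OF this, of "c m - c n"] show ?thesis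
        by (simp add: scale_left_diff_distrib algebra_simps)
    qed
    have "Cauchy c"
    proof (rule CauchyI)
      fix e :: real assume "e > 0"
      then have "d * e > 0" using d(1) by simp
      then obtain M where "\<forall>m\<ge>M. \<forall>n\<ge>M. norm (v m - v n) < d * e"
        using LIMSEQ_imp_Cauchy[OF lim] by (meson CauchyD)
      then have "\<forall>m\<ge>M. \<forall>n\<ge>M. d * norm (c m - c n) < d * e"
        using bound by (meson le_less_trans)
      then show "\<exists>M. \<forall>m\<ge>M. \<forall>n\<ge>M. norm (c m - c n) < e"
        using d(1) by auto
    qed
    then obtain c' where "c \<longlonglongrightarrow> c'"
      using Cauchy_convergent convergent_def by blast
    then have lim': "(\<lambda>n. v n - scale (c n) a) \<longlonglongrightarrow> l - scale c' a"
      using lim bounded_linear.tendsto[OF bounded_linear_scale_left] by (intro tendsto_diff) auto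
    have "l - scale c' a \<in> W"
      using assms(1) c lim' by (rule closed_sequentially)
    then show "l \<in> span (insert a W)"
      using assms(2) by (auto simp: span_breakdown_eq span_subspace_id)
  qed
qed

lemma closed_span_Un_finite:
  assumes "closed Y" "subspace Y" "finite B"
  shows "closed (span (Y \<union> B))"
  using assms(3)
proof (induction B rule: finite_induct)
  case empty
  then show ?case using assms by (simp add: span_subspace_id)
next
  case (insert b B)
  have "span (Y \<union> insert b B) = span (insert b (span (Y \<union> B)))"
    by (auto simp: span_breakdown_eq span_span)
  then show ?case
    using closed_span_insert[OF insert.IH] by simp
qed

lemma sum_eq_span: "subspace Y \<Longrightarrow> {y + f |y f. y \<in> Y \<and> f \<in> span B} = span (Y \<union> B)"
  by (simp add: span_Un span_subspace_id)

section \<open>Linear independence modulo a closed subspace and its stability\<close>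

text \<open>Linear independence of classes in the quotient X/Y, expressed without forming the
  quotient. An indexed family, unlike a set, can be perturbed entry by entry, and repetitions count
  as dependence.\<close>

definition independent_modulo :: "'a set \<Rightarrow> nat \<Rightarrow> (nat \<Rightarrow> 'a) \<Rightarrow> bool" where
  "independent_modulo Y n x \<longleftrightarrow>
     (\<forall>c. (\<Sum>i<n. scale (c i) (x i)) \<in> Y \<longrightarrow> (\<forall>i<n. c i = 0))"

text \<open>Coefficients are attached to indices, as \<open>independent_modulo\<close> requires,
  since \<open>x\<close> may repeat values.\<close>

lemma span_Un_image_lessThan:
  fixes n :: nat
  assumes "subspace Y" "v \<in> span (Y \<union> x ` {..<n})"
  obtains c where "v - (\<Sum>i<n. scale (c i) (x i)) \<in> Y"
proof -
  have "\<exists>c. v - (\<Sum>i<n. scale (c i) (x i)) \<in> Y"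
    using assms(2)
  proof (induction n arbitrary: v)
    case 0
    then show ?case using assms(1) by (simp add: span_subspace_id)
  next
    case (Suc n)
    then have "v \<in> span (insert (x n) (Y \<union> x ` {..<n}))"
      by (simp add: lessThan_Suc)
    then obtain k where "v - scale k (x n) \<in> span (Y \<union> x ` {..<n})"
      by (auto simp: span_breakdown_eq span_subspace_id)
    from Suc.IH[OF this] obtain c where
      "v - scale k (x n) - (\<Sum>i<n. scale (c i) (x i)) \<in> Y" by blast
    then show ?case
      by (intro exI[of _ "c(n := k)"]) (simp add: algebra_simps)
  qed
  then show thesis using that by blast
qed

lemma sum_in_span_image: "(\<Sum>i<(n::nat). scale (c i) (x i)) \<in> span (Y \<union> x ` {..<n})"
  by (intro span_sum span_scale span_base) auto

text \<open>This extension criterion drives the induction for the lower bound below, and later the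
  enlargement of a family of maximal length by one vector.\<close>

lemma independent_modulo_Suc:
  assumes "subspace Y"
  shows "independent_modulo Y (Suc n) x \<longleftrightarrow>
    independent_modulo Y n x \<and> x n \<notin> span (Y \<union> x ` {..<n})" (is "?L \<longleftrightarrow> ?R")
proof
  assume L: ?L
  have "independent_modulo Y n x"
    unfolding independent_modulo_def
  proof (intro allI impI)
    fix c i assume "(\<Sum>i<n. scale (c i) (x i)) \<in> Y" "i < n"
    with L[unfolded independent_modulo_def, rule_format, of "c(n := 0)" i]
    show "c i = 0" by simp
  qed
  moreover have "x n \<notin> span (Y \<union> x ` {..<n})"
  proof
    assume "x n \<in> span (Y \<union> x ` {..<n})"
    then obtain c where "x n - (\<Sum>i<n. scale (c i) (x i)) \<in> Y"
      using span_Un_image_lessThan assms by blast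
    with L[unfolded independent_modulo_def, rule_format, of "(\<lambda>i. - c i)(n := 1)" n]
    show False by (simp add: sum_negf)
  qed
  ultimately show ?R ..
next
  assume R: ?R
  show ?L
    unfolding independent_modulo_def
  proof (rule allI, rule impI)
    fix c assume c: "(\<Sum>i<Suc n. scale (c i) (x i)) \<in> Y"
    have "(\<Sum>i<n. scale (c i) (x i)) + scale (c n) (x n) \<in> span (Y \<union> x ` {..<n})"
      using c by (auto intro: span_base)
    then have "scale (c n) (x n) \<in> span (Y \<union> x ` {..<n})"
      using sum_in_span_image span_add_eq by blast
    then have "scale (inverse (c n)) (scale (c n) (x n)) \<in> span (Y \<union> x ` {..<n})"
      by (rule span_scale)
    then have "c n = 0"
      using R by (cases "c n = 0") auto
    then show "\<forall>i<Suc n. c i = 0"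
      using c R by (auto simp: independent_modulo_def less_Suc_eq)
  qed
qed

text \<open>Induction on \<open>n\<close>: the last vector has positive distance from the closed
  span \<open>W\<close> of \<open>Y\<close> and the earlier vectors, which controls its coefficient.
  Removing its term then leaves the induction hypothesis to control the others.\<close>

lemma independent_modulo_lower_bound:
  assumes "closed Y" "subspace Y" "independent_modulo Y n x"
  shows "\<exists>d>0. \<forall>c. \<forall>y\<in>Y. d * (\<Sum>i<n. norm (c i)) \<le> norm (y + (\<Sum>i<n. scale (c i) (x i)))"
  using assms(3)
proof (induction n)
  case 0
  show ?case by (auto intro: exI[of _ 1])
next
  case (Suc n)
  define W where "W = span (Y \<union> x ` {..<n})"
  have "independent_modulo Y n x" and xn: "x n \<notin> W"
    using Suc.prems independent_modulo_Suc[OF assms(2)] by (auto simp: W_def)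
  with Suc.IH obtain d where d: "d > 0"
    "\<And>c y. y \<in> Y \<Longrightarrow> d * (\<Sum>i<n. norm (c i)) \<le> norm (y + (\<Sum>i<n. scale (c i) (x i)))"
    by blast
  obtain e where e: "e > 0" "\<And>w c. w \<in> W \<Longrightarrow> e * norm c \<le> norm (w + scale c (x n))"
    using dist_closed_subspace[OF _ _ xn] closed_span_Un_finite[OF assms(1,2)]
    by (metis W_def finite_imageI finite_lessThan subspace_span)
  \<comment> \<open>The first summand accounts for the first \<open>n\<close> coefficients, the
    second for \<open>c n\<close>.\<close>
  define K where "K = (1 + norm (x n) / e) / d + 1 / e"
  have "K > 0"
    using d e by (auto simp: K_def intro!: add_nonneg_pos divide_nonneg_pos)
  have "inverse K * (\<Sum>i<Suc n. norm (c i)) \<le> norm (y + (\<Sum>i<Suc n. scale (c i) (x i)))"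
    if y: "y \<in> Y" for c y
  proof -
    let ?w = "y + (\<Sum>i<n. scale (c i) (x i))"
    let ?N = "norm (?w + scale (c n) (x n))"
    have "?w \<in> W"
      unfolding W_def using y by (intro span_add[OF span_base sum_in_span_image]) simp
    then have cn: "norm (c n) \<le> ?N / e"
      using e by (simp add: pos_le_divide_eq mult.commute)
    have "d * (\<Sum>i<n. norm (c i)) \<le> norm ?w"
      using d y by blast
    also have "\<dots> \<le> ?N + norm (c n) * norm (x n)"
      using norm_triangle_ineq4[of "?w + scale (c n) (x n)" "scale (c n) (x n)"]
      by (simp add: norm_scale)
    also have "\<dots> \<le> ?N + ?N / e * norm (x n)"
      using mult_right_mono[OF cn, of "norm (x n)"] by simp
    also have "\<dots> = (1 + norm (x n) / e) * ?N"
      by (simp add: algebra_simps)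
    finally have "(\<Sum>i<n. norm (c i)) \<le> (1 + norm (x n) / e) / d * ?N"
      using d(1) by (simp add: field_simps)
    then have "(\<Sum>i<Suc n. norm (c i)) \<le> K * ?N"
      using cn by (simp add: K_def algebra_simps)
    then show ?thesis
      using \<open>K > 0\<close> by (simp add: field_simps)
  qed
  then show ?case
    using \<open>K > 0\<close> by (intro exI[of _ "inverse K"]) auto
qed

text \<open>Moving each vector by less than half the constant of the lower bound changes a
  combination by at most half of what that bound guarantees, so a combination of the new vectors
  lying in \<open>Y\<close> has only zero coefficients.\<close>

lemma independent_modulo_perturb:
  assumes "closed Y" "subspace Y" "independent_modulo Y n x"
  obtains d where "d > 0"
    "\<And>x'. (\<And>i. i < n \<Longrightarrow> norm (x' i - x i) < d) \<Longrightarrow> independent_modulo Y n x'"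
proof -
  obtain d where d: "d > 0"
    "\<And>c y. y \<in> Y \<Longrightarrow> d * (\<Sum>i<n. norm (c i)) \<le> norm (y + (\<Sum>i<n. scale (c i) (x i)))"
    using independent_modulo_lower_bound[OF assms] by blast
  have "independent_modulo Y n x'" if x': "\<And>i. i < n \<Longrightarrow> norm (x' i - x i) < d / 2" for x'
    unfolding independent_modulo_def
  proof (rule allI, rule impI)
    fix c assume "(\<Sum>i<n. scale (c i) (x' i)) \<in> Y"
    then have "- (\<Sum>i<n. scale (c i) (x' i)) \<in> Y"
      using assms(2) by (rule subspace_neg[rotated])
    then have "d * (\<Sum>i<n. norm (c i))
        \<le> norm (- (\<Sum>i<n. scale (c i) (x' i)) + (\<Sum>i<n. scale (c i) (x i)))"
      by (rule d(2))
    also have "\<dots> = norm (\<Sum>i<n. scale (c i) (x i - x' i))"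
      by (simp add: scale_right_diff_distrib sum_subtractf)
    also have "\<dots> \<le> (\<Sum>i<n. norm (c i) * (d / 2))"
    proof (rule sum_norm_le)
      fix i assume "i \<in> {..<n}"
      then have "norm (x i - x' i) \<le> d / 2"
        using x'[of i] by (simp add: norm_minus_commute)
      then show "norm (scale (c i) (x i - x' i)) \<le> norm (c i) * (d / 2)"
        unfolding norm_scale by (rule mult_left_mono) simp
    qed
    also have "\<dots> = d / 2 * (\<Sum>i<n. norm (c i))"
      by (simp add: sum_distrib_left mult.commute)
    finally have "(\<Sum>i<n. norm (c i)) \<le> 0"
      using d(1) by (simp add: mult_le_0_iff)
    then have "(\<Sum>i<n. norm (c i)) = 0"
      by (simp add: antisym sum_nonneg)
    then show "\<forall>i<n. c i = 0"
      by (auto simp: sum_nonneg_eq_0_iff)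
  qed
  then show thesis
    using that[of "d / 2"] d(1) by simp
qed

text \<open>Modulo \<open>Y\<close> each \<open>x i\<close> can be replaced by a vector
  \<open>f i\<close> of \<open>span B\<close>, and the \<open>f i\<close> are still
  independent.\<close>

lemma independent_modulo_span_bound:
  assumes "subspace Y" "finite B" "independent_modulo Y n x"
    and "\<And>i. i < n \<Longrightarrow> x i \<in> span (Y \<union> B)"
  shows "n \<le> card B"
proof -
  have "\<forall>i\<in>{..<n}. \<exists>f. f \<in> span B \<and> x i - f \<in> Y"
    using assms(1,4) by (fastforce simp: span_Un span_subspace_id)
  then obtain f where f: "\<And>i. i < n \<Longrightarrow> f i \<in> span B" "\<And>i. i < n \<Longrightarrow> x i - f i \<in> Y"
    by (metis lessThan_iff)
  have zero: "c i = 0" if "(\<Sum>i<n. scale (c i) (f i)) = 0" "i < n" for c i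
  proof -
    have "(\<Sum>i<n. scale (c i) (x i)) = (\<Sum>i<n. scale (c i) (x i - f i))"
      using that(1) by (simp add: scale_right_diff_distrib sum_subtractf)
    also have "\<dots> \<in> Y"
      using f(2) assms(1) by (intro subspace_sum subspace_scale) auto
    finally show ?thesis
      using assms(3) that(2) by (auto simp: independent_modulo_def)
  qed
  \<comment> \<open>\<open>independent\<close> concerns the set of values, so injectivity is what
    gives that set \<open>n\<close> elements. A repetition would be the relation with coefficients 1
    and -1.\<close>
  have inj: "inj_on f {..<n}"
  proof (rule inj_onI, rule ccontr)
    fix i j assume ij: "i \<in> {..<n}" "j \<in> {..<n}" "f i = f j" "i \<noteq> j"
    define c where "c k = (if k = i then 1 else if k = j then - 1 else 0 :: 'k)" for k
    have "(\<Sum>k<n. scale (c k) (f k)) = (\<Sum>k\<in>{i, j}. scale (c k) (f k))"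
      using ij by (intro sum.mono_neutral_right) (auto simp: c_def)
    also have "\<dots> = 0"
      using ij by (simp add: c_def)
    finally have "c i = 0" using zero ij(1) by blast
    then show False by (simp add: c_def)
  qed
  have "independent (f ` {..<n})"
  proof (rule independent_if_scalars_zero)
    fix u v assume "(\<Sum>v\<in>f ` {..<n}. scale (u v) v) = 0" "v \<in> f ` {..<n}"
    then show "u v = 0"
      using zero[of "\<lambda>i. u (f i)"] inj by (auto simp: sum.reindex)
  qed simp
  then have "card (f ` {..<n}) \<le> card B"
    using independent_span_bound[OF assms(2)] f(1) by blast
  then show ?thesis
    using inj by (simp add: card_image)
qed

section \<open>Rank modulo \<open>Y\<close> and Baire's theorem\<close>

text \<open>The rank in question is that of the map from Y to X/Y induced by \<open>S\<close>. The
  lower bound on it makes sense for infinite rank too and is the open condition that Baire's theorem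
  calls for.\<close>

definition rank_ge :: "'a set \<Rightarrow> nat \<Rightarrow> ('a \<Rightarrow>\<^sub>L 'a) \<Rightarrow> bool" where
  "rank_ge Y n S \<longleftrightarrow>
     (\<exists>y. (\<forall>i<n. y i \<in> Y) \<and> independent_modulo Y n (\<lambda>i. blinfun_apply S (y i)))"

text \<open>The vectors \<open>y i\<close> that witness the rank of \<open>S\<close> serve for every
  nearby operator, because their images move little.\<close>

lemma open_rank_ge:
  assumes "closed Y" "subspace Y"
  shows "open {S. rank_ge Y n S}"
proof (rule openI)
  fix S assume "S \<in> {S. rank_ge Y n S}"
  then obtain y where y: "\<forall>i<n. y i \<in> Y" "independent_modulo Y n (\<lambda>i. blinfun_apply S (y i))"
    by (auto simp: rank_ge_def)
  obtain d where d: "d > 0"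
    "\<And>x'. (\<And>i. i < n \<Longrightarrow> norm (x' i - blinfun_apply S (y i)) < d) \<Longrightarrow> independent_modulo Y n x'"
    using independent_modulo_perturb[OF assms y(2)] by blast
  \<comment> \<open>A common bound for the norms of the \<open>y i\<close>; the 1 keeps it positive
    even if the sum vanishes.\<close>
  define K where "K = 1 + (\<Sum>i<n. norm (y i))"
  have "K > 0"
    by (simp add: K_def add_pos_nonneg sum_nonneg)
  have "rank_ge Y n R" if "dist S R < d / K" for R
  proof -
    have "norm (blinfun_apply R (y i) - blinfun_apply S (y i)) < d" if "i < n" for i
    proof -
      have "norm (y i) \<le> (\<Sum>i<n. norm (y i))"
        using that by (intro member_le_sum) auto
      then have "norm (y i) \<le> K" by (simp add: K_def)
      have "norm (blinfun_apply R (y i) - blinfun_apply S (y i)) \<le> norm (R - S) * norm (y i)"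
        by (metis blinfun.diff_left norm_blinfun)
      also have "\<dots> \<le> norm (R - S) * K"
        using \<open>norm (y i) \<le> K\<close> by (rule mult_left_mono) simp
      also have "\<dots> < d"
        using \<open>dist S R < d / K\<close> \<open>K > 0\<close> by (simp add: dist_norm norm_minus_commute field_simps)
      finally show ?thesis .
    qed
    then have "independent_modulo Y n (\<lambda>i. blinfun_apply R (y i))"
      by (rule d(2))
    with y(1) show ?thesis
      by (auto simp: rank_ge_def)
  qed
  then show "\<exists>e>0. ball S e \<subseteq> {S. rank_ge Y n S}"
    using d(1) \<open>K > 0\<close> by (intro exI[of _ "d / K"]) auto
qed

lemma almost_invariant_rank_bounded:
  assumes "subspace Y" "almost_invariant Y S"
  obtains n where "\<not> rank_ge Y n S"
proof -
  obtain B where B: "finite B" "blinfun_apply S ` Y \<subseteq> span (Y \<union> B)"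
    using assms by (auto simp: almost_invariant_def finite_dim_subspace_def sum_eq_span)
  have "\<not> rank_ge Y (Suc (card B)) S"
  proof
    assume "rank_ge Y (Suc (card B)) S"
    then obtain y where y: "\<forall>i<Suc (card B). y i \<in> Y"
        "independent_modulo Y (Suc (card B)) (\<lambda>i. blinfun_apply S (y i))"
      by (auto simp: rank_ge_def)
    then show False
      using independent_modulo_span_bound[OF assms(1) B(1) y(2)] B(2)
      by (meson Suc_n_not_le_n image_subset_iff)
  qed
  then show thesis using that by blast
qed

text \<open>The sets \<open>U n\<close> are relatively open in the complete space \<open>A\<close>,
  and their intersection is empty since each single operator has finite rank. By Baire's theorem
  they cannot all be dense, so some \<open>U n\<close> misses a ball about a point of
  \<open>A\<close>.\<close>

lemma locally_bounded_rank:
  assumes "closed Y" "subspace Y" "closed A" "A \<noteq> {}"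
    and "\<And>S. S \<in> A \<Longrightarrow> almost_invariant Y S"
  obtains n S e where "S \<in> A" "e > 0" "\<And>R. R \<in> A \<Longrightarrow> dist S R < e \<Longrightarrow> \<not> rank_ge Y n R"
proof -
  define U where "U n = A \<inter> {S. rank_ge Y n S}" for n
  have "S \<notin> \<Inter> (range U)" for S
  proof
    assume S: "S \<in> \<Inter> (range U)"
    then have "almost_invariant Y S"
      using assms(5) by (auto simp: U_def)
    then obtain n where "\<not> rank_ge Y n S"
      using almost_invariant_rank_bounded[OF assms(2)] by metis
    with S show False
      by (auto simp: U_def)
  qed
  then have "\<Inter> (range U) = {}"
    by blast
  have "completely_metrizable_space (top_of_set A)"
    using assms(3) completely_metrizable_space_euclidean
    by (intro completely_metrizable_space_closedin) auto
  then have "\<exists>n. (top_of_set A) closure_of (U n) \<noteq> A"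
  proof (rule contrapos_pp)
    assume "\<nexists>n. (top_of_set A) closure_of (U n) \<noteq> A"
    then have "openin (top_of_set A) T \<and> (top_of_set A) closure_of T = topspace (top_of_set A)"
      if "T \<in> range U" for T
      using that open_rank_ge[OF assms(1,2)] by (auto simp: U_def openin_open_Int)
    then have "completely_metrizable_space (top_of_set A) \<Longrightarrow>
        (top_of_set A) closure_of (\<Inter> (range U)) = A"
      using Baire_category[of "top_of_set A" "range U"] by simp
    then show "\<not> completely_metrizable_space (top_of_set A)"
      using \<open>\<Inter> (range U) = {}\<close> assms(4) by auto
  qed
  then obtain n where "A \<inter> closure (A \<inter> U n) \<noteq> A"
    by (auto simp: closure_of_subtopology)
  then obtain S where S: "S \<in> A" "S \<notin> closure (U n)"
    by (auto simp: U_def Int_left_absorb)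
  then obtain e where "e > 0" "\<forall>R\<in>U n. \<not> dist R S < e"
    by (auto simp: closure_approachable)
  then show thesis
    using that[of S e n] S(1) by (auto simp: U_def dist_commute)
qed

section \<open>Construction of the invariant half-space\<close>

text \<open>Closedness of \<open>A\<close> feeds Baire's theorem, sums and scalar multiples keep the
  perturbed operators in \<open>A\<close>, and products make \<open>Z\<close> invariant.\<close>

lemma closed_subalgebra_invariant_half_space:
  assumes A: "closed_subalgebra A" and Y: "half_space Y"
    and almost: "\<And>S. S \<in> A \<Longrightarrow> almost_invariant Y S"
  obtains Z where "half_space Z" "\<And>S. S \<in> A \<Longrightarrow> invariant_under Z S"
proof -
  have Y': "closed Y" "subspace Y"
    using Y by (auto simp: half_space_def)
  have lin: "blinfun_apply S (scale c x) = scale c (blinfun_apply S x)" if "S \<in> A" for S c x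
    using A that by (auto simp: closed_subalgebra_def operators_def)
  have A': "closed A" "A \<noteq> {}"
    using A by (auto simp: closed_subalgebra_def)
  obtain n S0 e where ball: "S0 \<in> A" "e > 0"
      "\<And>R. R \<in> A \<Longrightarrow> dist S0 R < e \<Longrightarrow> \<not> rank_ge Y n R"
    using locally_bounded_rank[OF Y' A' almost] by metis
  define P where "P m \<longleftrightarrow> (\<exists>S\<in>A. dist S0 S < e \<and> rank_ge Y m S)" for m
  \<comment> \<open>Trailing vectors of a witnessing family are dropped one at a time. The ball
    excludes only the value \<open>n\<close> directly; this extends the exclusion to all larger
    values.\<close>
  have mono: "rank_ge Y j S" if "rank_ge Y k S" "j \<le> k" for j k S
    using that(2,1)
  proof (induction rule: inc_induct)
    case (step i)
    then show ?case
      by (auto simp: rank_ge_def independent_modulo_Suc[OF Y'(2)]) (metis less_SucI)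
  qed simp
  have "rank_ge Y 0 S0"
    by (simp add: rank_ge_def independent_modulo_def)
  then have "P 0"
    using ball(1,2) unfolding P_def by (intro bexI[of _ S0]) auto
  have bound: "k \<le> n" if "P k" for k
  proof (rule ccontr)
    assume "\<not> k \<le> n"
    then show False
      using that ball(3) mono[of k _ n] by (auto simp: P_def)
  qed
  define m where "m = Greatest P"
  have "P m"
    unfolding m_def using \<open>P 0\<close> bound by (rule GreatestI_nat)
  have max: "k \<le> m" if "P k" for k
    unfolding m_def using that bound by (rule Greatest_le_nat)
  from \<open>P m\<close> obtain S y where S: "S \<in> A" "dist S0 S < e" "\<And>i. i < m \<Longrightarrow> y i \<in> Y"
      "independent_modulo Y m (\<lambda>i. blinfun_apply S (y i))"
    by (auto simp: P_def rank_ge_def)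
  define C where "C = (\<lambda>i. blinfun_apply S (y i)) ` {..<m}"
  define V where "V = span (Y \<union> C)"
  have V: "closed V" "subspace V" "Y \<subseteq> V"
    using closed_span_Un_finite[OF Y'] by (auto simp: V_def C_def intro: span_base)

  have key: "blinfun_apply R z \<in> V" if R: "R \<in> A" and z: "z \<in> Y" "blinfun_apply S z \<in> Y" for R z
  proof (rule ccontr)
    assume notin: "blinfun_apply R z \<notin> V"
    define x where "x i = (if i < m then blinfun_apply S (y i) else blinfun_apply R z)" for i
    have "independent_modulo Y (Suc m) x"
    proof -
      have "independent_modulo Y m x"
        using S(4) by (simp add: independent_modulo_def x_def)
      moreover have "x ` {..<m} = C"
        by (auto simp: x_def C_def)
      ultimately show ?thesis
        using notin by (simp add: independent_modulo_Suc[OF Y'(2)] V_def x_def)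
    qed
    then obtain d where d: "d > 0"
      "\<And>x'. (\<And>i. i < Suc m \<Longrightarrow> norm (x' i - x i) < d) \<Longrightarrow> independent_modulo Y (Suc m) x'"
      using independent_modulo_perturb[OF Y'] by blast
    \<comment> \<open>One constant for two purposes: it dominates \<open>norm R\<close>, which keeps
      the perturbed operator in the ball, and the norms of the \<open>R (y i)\<close>, which keeps
      the images close. The factor 2 in \<open>t\<close> makes both resulting inequalities
      strict.\<close>
    define K where "K = 1 + norm R + (\<Sum>i<m. norm (blinfun_apply R (y i)))"
    define t where "t = min d (e - dist S0 S) / (2 * K)"
    have "K > 0"
      unfolding K_def by (intro add_pos_nonneg sum_nonneg) auto
    have t: "t > 0"
      using \<open>K > 0\<close> d(1) S(2) by (simp add: t_def)
    have "t * K < d" "t * K < e - dist S0 S"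
      using \<open>K > 0\<close> d(1) S(2) by (auto simp: t_def min_def)
    define Q where "Q = S + scale_op (of_real t) R"
    have Q_apply: "blinfun_apply Q v = blinfun_apply S v + t *\<^sub>R blinfun_apply R v" for v
      by (simp add: Q_def blinfun.add_left scale_op_apply scale_of_real)
    have "Q \<in> A"
      using A S(1) R by (auto simp: Q_def closed_subalgebra_def)
    moreover have "dist S0 Q < e"
    proof -
      have "Q = S + t *\<^sub>R R"
        by (rule blinfun_eqI) (simp add: Q_apply blinfun.add_left blinfun.scaleR_left)
      then have "dist S Q = t * norm R"
        using t by (simp add: dist_norm)
      also have "\<dots> \<le> t * K"
        using t by (intro mult_left_mono) (auto simp: K_def sum_nonneg)
      finally show ?thesis
        using \<open>t * K < e - dist S0 S\<close> dist_triangle[of S0 Q S] by linarith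
    qed
    moreover have "rank_ge Y (Suc m) Q"
    proof -
      define y' where "y' i = (if i < m then y i else (1 / t) *\<^sub>R z)" for i
      text \<open>Modulo \<^term>\<open>Y\<close>, the image of \<^term>\<open>(1 / t) *\<^sub>R z\<close> under \<^term>\<open>Q\<close> is exactly
        \<^term>\<open>blinfun_apply R z\<close>, however large \<^term>\<open>1 / t\<close> is.\<close>
      define x' where "x' i = (if i < m then blinfun_apply Q (y i) else blinfun_apply R z)" for i
      have x': "independent_modulo Y (Suc m) x'"
      proof (rule d(2))
        fix i assume "i < Suc m"
        show "norm (x' i - x i) < d"
        proof (cases "i < m")
          case True
          then have "norm (x' i - x i) = t * norm (blinfun_apply R (y i))"
            using t by (simp add: x'_def x_def Q_apply)
          also have "norm (blinfun_apply R (y i)) \<le> (\<Sum>i<m. norm (blinfun_apply R (y i)))"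
            using True by (intro member_le_sum) auto
          then have "t * norm (blinfun_apply R (y i)) \<le> t * K"
            using t by (intro mult_left_mono) (auto simp: K_def intro: add_increasing)
          finally show ?thesis
            using \<open>t * K < d\<close> by simp
        qed (simp add: x'_def x_def d(1))
      qed
      have sub: "r *\<^sub>R v \<in> Y" if "v \<in> Y" for r v
        using subspace_scale[OF Y'(2) that, of "of_real r"] by (simp add: scale_of_real)
      have "independent_modulo Y (Suc m) (\<lambda>i. blinfun_apply Q (y' i))"
        unfolding independent_modulo_def
      proof (intro allI impI)
        fix c i assume c: "(\<Sum>i<Suc m. scale (c i) (blinfun_apply Q (y' i))) \<in> Y" and i: "i < Suc m"
        have "blinfun_apply Q (y' m) = (1 / t) *\<^sub>R blinfun_apply S z + x' m"
          using t by (simp add: y'_def x'_def Q_apply blinfun.scaleR_right scaleR_add_right)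
        \<comment> \<open>The two families differ only in the last entry, by a multiple of the
          vector \<open>S z\<close> of \<open>Y\<close>.\<close>
        then have "(\<Sum>i<Suc m. scale (c i) (x' i)) =
            (\<Sum>i<Suc m. scale (c i) (blinfun_apply Q (y' i)))
            - scale (c m) ((1 / t) *\<^sub>R blinfun_apply S z)"
          by (simp add: scale_right_distrib x'_def y'_def)
        also have "\<dots> \<in> Y"
          using c z(2) sub by (intro subspace_diff subspace_scale Y'(2)) auto
        finally show "c i = 0"
          using x' i by (auto simp: independent_modulo_def)
      qed
      moreover have "\<forall>i<Suc m. y' i \<in> Y"
        using S(3) z(1) sub by (simp add: y'_def)
      ultimately show ?thesis
        unfolding rank_ge_def by blast
    qed
    ultimately have "P (Suc m)"
      by (auto simp: P_def)
    then show False
      using max by fastforce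
  qed

  \<comment> \<open>Here \<open>S z\<close> need not lie in \<open>Y\<close>, so \<open>key\<close>
    does not apply; instead \<open>z\<close> itself would lengthen the family for
    \<open>S\<close>.\<close>
  have SV: "blinfun_apply S z \<in> V" if "z \<in> Y" for z
  proof (rule ccontr)
    assume "blinfun_apply S z \<notin> V"
    then have "independent_modulo Y (Suc m) (\<lambda>i. blinfun_apply S ((y(m := z)) i))"
      using S(4) by (simp add: independent_modulo_Suc[OF Y'(2)] V_def C_def)
        (simp add: independent_modulo_def)
    moreover have "\<forall>i<Suc m. (y(m := z)) i \<in> Y"
      using S(3) that by simp
    ultimately have "P (Suc m)"
      using S(1,2) unfolding P_def rank_ge_def by blast
    then show False
      using max by fastforce
  qed

  \<comment> \<open>The largest subset of \<open>V\<close> invariant under \<open>A\<close>.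
    Membership in \<open>V\<close> is demanded separately because \<open>A\<close> may lack the
    identity.\<close>
  define Z where "Z = {z \<in> V. \<forall>R\<in>A. blinfun_apply R z \<in> V}"
  have "Z = V \<inter> (\<Inter>R\<in>A. blinfun_apply R -` V)"
    by (auto simp: Z_def)
  then have "closed Z"
    using V(1) by (auto intro!: closed_INT closed_Int continuous_closed_vimage continuous_intros)
  moreover have "subspace Z"
    using V(2) lin by (auto simp: Z_def subspace_def blinfun.add_right)
  moreover have "\<not> finite_dim_subspace Z"
  proof
    assume "finite_dim_subspace Z"
    then obtain B where B: "finite B" "Z = span B"
      by (auto simp: finite_dim_subspace_def)
    have "Y \<subseteq> span (B \<union> y ` {..<m})"
    proof
      fix z assume z: "z \<in> Y"
      \<comment> \<open>Subtracting the same combination of the \<open>y i\<close> from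
        \<open>z\<close> leaves a vector \<open>w\<close> of \<open>Y\<close> with
        \<open>S w\<close> in \<open>Y\<close>, to which \<open>key\<close> applies. Thus
        \<open>Y\<close> exceeds its part in \<open>Z\<close> by at most the span of the
        \<open>y i\<close>.\<close>
      obtain c where c: "blinfun_apply S z - (\<Sum>i<m. scale (c i) (blinfun_apply S (y i))) \<in> Y"
        using span_Un_image_lessThan[OF Y'(2)] SV[OF z] unfolding V_def C_def by blast
      define w where "w = z - (\<Sum>i<m. scale (c i) (y i))"
      have "w \<in> Y"
        using z S(3) by (auto simp: w_def intro!: subspace_diff subspace_sum subspace_scale Y'(2))
      moreover have "blinfun_apply S w \<in> Y"
        using c by (simp add: w_def blinfun.diff_right blinfun.sum_right lin[OF S(1)])
      ultimately have "w \<in> span B"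
        using key V(3) unfolding B(2)[symmetric] Z_def by blast
      then have "w + (\<Sum>i<m. scale (c i) (y i)) \<in> span (B \<union> y ` {..<m})"
        using span_mono[of B "B \<union> y ` {..<m}"] sum_in_span_image by (intro span_add) auto
      then show "z \<in> span (B \<union> y ` {..<m})"
        by (simp add: w_def)
    qed
    \<comment> \<open>\<open>finite_dim_subspace\<close> asks for an exact spanning set, so a basis
      is chosen inside \<open>Y\<close>; it is finite because \<open>Y\<close> lies in a finitely
      spanned space.\<close>
    then obtain B' where "B' \<subseteq> Y" "independent B'" "Y \<subseteq> span B'" "finite B'"
      using maximal_independent_subset[of Y] independent_span_bound[of "B \<union> y ` {..<m}"] B(1)
      by (metis finite_Un finite_imageI finite_lessThan order_trans)
    then have "Y = span B'"
      using span_minimal[OF _ Y'(2)] by blast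
    then show False
      using Y \<open>finite B'\<close> unfolding half_space_def finite_dim_subspace_def by blast
  qed
  moreover have "\<not> (\<exists>F. finite_dim_subspace F \<and> {z + f |z f. z \<in> Z \<and> f \<in> F} = UNIV)"
  proof
    assume "\<exists>F. finite_dim_subspace F \<and> {z + f |z f. z \<in> Z \<and> f \<in> F} = UNIV"
    then obtain B where B: "finite B" "span (Z \<union> B) = UNIV"
      using sum_eq_span[OF \<open>subspace Z\<close>] by (auto simp: finite_dim_subspace_def)
    \<comment> \<open>\<open>Z\<close> lies in \<open>V\<close>, which exceeds \<open>Y\<close> only
      by the span of the finite set \<open>C\<close>; a finite-dimensional complement for
      \<open>Z\<close> would thus yield one for \<open>Y\<close>.\<close>
    have "Z \<union> B \<subseteq> span (Y \<union> (C \<union> B))"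
      using span_mono[of "Y \<union> C" "Y \<union> (C \<union> B)"] by (auto simp: Z_def V_def intro: span_base)
    then have "span (Y \<union> (C \<union> B)) = UNIV"
      using B(2) span_minimal[OF _ subspace_span] by blast
    moreover have "finite (C \<union> B)"
      using B(1) by (simp add: C_def)
    ultimately have "finite_dim_subspace (span (C \<union> B)) \<and>
        {y + f |y f. y \<in> Y \<and> f \<in> span (C \<union> B)} = UNIV"
      unfolding sum_eq_span[OF Y'(2)] finite_dim_subspace_def by blast
    then have "\<exists>F. finite_dim_subspace F \<and> {y + f |y f. y \<in> Y \<and> f \<in> F} = UNIV"
      by (rule exI)
    then show False
      using Y unfolding half_space_def by (elim conjE) (rule notE)
  qed
  ultimately have "half_space Z"
    by (simp add: half_space_def)
  moreover have "invariant_under Z R" if R: "R \<in> A" for R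
    unfolding invariant_under_def
  proof (rule image_subsetI)
    fix z assume z: "z \<in> Z"
    have "blinfun_apply Q (blinfun_apply R z) \<in> V" if "Q \<in> A" for Q
    proof -
      have "Q o\<^sub>L R \<in> A"
        using A R that by (auto simp: closed_subalgebra_def)
      then have "blinfun_apply (Q o\<^sub>L R) z \<in> V"
        using z unfolding Z_def by blast
      then show ?thesis by simp
    qed
    then show "blinfun_apply R z \<in> Z"
      using z R by (auto simp: Z_def)
  qed
  ultimately show thesis
    using that by blast
qed

end

theorem theorem3p6:
  fixes scale :: "'k::{real_normed_field,banach} \<Rightarrow> 'a::banach \<Rightarrow> 'a"
    and T :: "'a \<Rightarrow>\<^sub>L 'a"
  assumes "banach_space_over scale"
    and "T \<in> banach_space_over.operators scale"
    and "\<exists>Y. banach_space_over.half_space scale Y \<and>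
          (\<forall>S \<in> banach_space_over.generated_closed_algebra scale T.
             banach_space_over.almost_invariant scale Y S)"
  shows "\<exists>Y. banach_space_over.half_space scale Y \<and>
          (\<forall>S \<in> banach_space_over.generated_closed_algebra scale T. invariant_under Y S)"
proof -
  interpret banach_space_over scale by fact
  show ?thesis
    using assms(3) closed_subalgebra_invariant_half_space[OF closed_subalgebra_generated[OF assms(2)]]
    by metis
qed

end
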